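(* For every integer $k\ge 1$, the diameter $h(k)$ of the graph $\mathcal{G}_k$ satisfies \[h(k)\le \tfrac{3}{2}k+4.\] Equivalently, every permutation $\pi\in\mathcal{S}_k$ can be transformed into the identity permutation $\mathrm{Id}_k$ by a sequence of at most $\tfrac{3}{2}k+4$ operations, each of which is a prefix reversal or a suffix reversal.
   Context: For a positive integer $k$, $\mathcal{S}_k$ denotes the set of permutations of $[k]=\{1,\dots,k\}$, viewed as sequences $(\pi(1),\dots,\pi(k))$. Two permutations $\pi,\tau\in\mathcal{S}_k$ are related by a prefix reversal if there is $t\in[k]$ such that $\tau$ is obtained from $\pi$ by reversing the order of the first $t$ entries (i.e. $\tau(i)=\pi(t+1-i)$ for $i\le t$ and $\tau(i)=\pi(i)$ for $i>t$). They are related by a suffix reversal if there is $t\in[k]$ such that $\tau$ is obtained from $\pi$ by reversing the order of the entries in positions $t,\dots,k$ (i.e. $\tau(i)=\pi(i)$ for $i<t$ and $\tau(i)=\pi(k+t-i)$ for $i\ge t$). $\mathcal{G}_k$ is the graph with vertex set $\mathcal{S}_k$ in which $\pi,\tau$ are adjacent if they are related by a prefix reversal or by a suffix reversal, and $h(k)$ is the diameter of $\mathcal{G}_k$ (which equals $\max_{\pi\in\mathcal{S}_k} d_{\mathcal{G}_k}(\pi,\mathrm{Id}_k)$). *)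

theory Defs
  imports
    "HOL-Combinatorics.Multiset_Permutations"
    "Graph_Theory.Graph_Theory"
begin

text \<open>
  Permutations of \<open>{1..k}\<close> are sequences, i.e. lists, of length \<open>k\<close>. Positions are counted from 1
  as in the mathematical text, so the entry \<open>\<pi>(i)\<close> is the list element \<open>\<pi> ! (i - 1)\<close>.
\<close>

definition perms :: "nat \<Rightarrow> nat list set" where
  "perms k = permutations_of_set {1..k}"

definition id_perm :: "nat \<Rightarrow> nat list" where
  "id_perm k = [1..<Suc k]"

definition prefix_reversal :: "nat \<Rightarrow> 'a list \<Rightarrow> 'a list" where
  "prefix_reversal t xs = rev (take t xs) @ drop t xs"

definition suffix_reversal :: "nat \<Rightarrow> 'a list \<Rightarrow> 'a list" where
  "suffix_reversal t xs = take (t - 1) xs @ rev (drop (t - 1) xs)"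

lemma length_prefix_reversal [simp]: "length (prefix_reversal t xs) = length xs"
  by (simp add: prefix_reversal_def)

lemma length_suffix_reversal [simp]: "length (suffix_reversal t xs) = length xs"
  by (simp add: suffix_reversal_def)

lemma nth_prefix_reversal:
  assumes "length xs = k" "t \<in> {1..k}" "i \<in> {1..k}"
  shows "prefix_reversal t xs ! (i - 1) =
    (if i \<le> t then xs ! ((t + 1 - i) - 1) else xs ! (i - 1))"
  using assms by (auto simp: prefix_reversal_def nth_append rev_nth min_def)

lemma nth_suffix_reversal:
  assumes "length xs = k" "t \<in> {1..k}" "i \<in> {1..k}"
  shows "suffix_reversal t xs ! (i - 1) =
    (if i < t then xs ! (i - 1) else xs ! ((k + t - i) - 1))"
proof (cases "i < t")
  case True
  then show ?thesis using assms by (auto simp: suffix_reversal_def nth_append)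
next
  case False
  then have "suffix_reversal t xs ! (i - 1) = rev (drop (t - 1) xs) ! (i - t)"
    using assms by (auto simp: suffix_reversal_def nth_append min_def)
  also have "\<dots> = drop (t - 1) xs ! (k - (t - 1) - Suc (i - t))"
    using assms False by (subst rev_nth) auto
  also have "\<dots> = xs ! ((t - 1) + (k - (t - 1) - Suc (i - t)))"
    using assms False by (subst nth_drop) auto
  also have "(t - 1) + (k - (t - 1) - Suc (i - t)) = (k + t - i) - 1"
    using assms False by auto
  finally show ?thesis using False by simp
qed

definition reversal_rel :: "nat \<Rightarrow> nat list rel" where
  "reversal_rel k = {(\<pi>, \<tau>). \<pi> \<in> perms k \<and> \<tau> \<in> perms k \<and>
     ((\<exists>t\<in>{1..k}. \<tau> = prefix_reversal t \<pi>) \<or> (\<exists>t\<in>{1..k}. \<tau> = suffix_reversal t \<pi>))}"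

text \<open>
  The trivial reversals of a single entry relate every permutation to itself; as usual, the graph
  is taken to be simple, so these loops are dropped. This does not affect distances.
\<close>

definition reversal_graph :: "nat \<Rightarrow> nat list pair_pre_digraph" where
  "reversal_graph k = \<lparr> pverts = perms k, parcs = {(\<pi>, \<tau>) \<in> reversal_rel k. \<pi> \<noteq> \<tau>} \<rparr>"

text \<open>
  Distances are infima of walk lengths (all arc weights are 1) in the extended reals, so a finite
  upper bound on the diameter entails in particular that the graph is connected.
\<close>

definition graph_dist :: "('a, 'b) pre_digraph \<Rightarrow> 'a \<Rightarrow> 'a \<Rightarrow> ereal" where
  "graph_dist G u v = wf_digraph.\<mu> G (\<lambda>_. 1) u v"

definition graph_diameter :: "('a, 'b) pre_digraph \<Rightarrow> ereal" where
  "graph_diameter G = (SUP u\<in>verts G. SUP v\<in>verts G. graph_dist G u v)"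

definition h :: "nat \<Rightarrow> ereal" where
  "h k = graph_diameter (with_proj (reversal_graph k))"

lemma length_perms: "\<pi> \<in> perms k \<Longrightarrow> length \<pi> = k"
  by (auto simp: perms_def dest: length_finite_permutations_of_set)

lemma id_perm_in_perms: "id_perm k \<in> perms k"
  by (auto simp: id_perm_def perms_def permutations_of_set_def)

lemma prefix_reversal_in_perms: "\<pi> \<in> perms k \<Longrightarrow> prefix_reversal t \<pi> \<in> perms k"
proof -
  assume *: "\<pi> \<in> perms k"
  have "mset (prefix_reversal t \<pi>) = mset \<pi>"
    unfolding prefix_reversal_def mset_append mset_rev
    by (metis append_take_drop_id mset_append)
  with * show ?thesis
    by (metis mset_eq_imp_distinct_iff mset_eq_setD perms_def permutations_of_setD
        permutations_of_setI)
qed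

lemma suffix_reversal_in_perms: "\<pi> \<in> perms k \<Longrightarrow> suffix_reversal t \<pi> \<in> perms k"
proof -
  assume *: "\<pi> \<in> perms k"
  have "mset (suffix_reversal t \<pi>) = mset \<pi>"
    unfolding suffix_reversal_def mset_append mset_rev
    by (metis append_take_drop_id mset_append)
  with * show ?thesis
    by (metis mset_eq_imp_distinct_iff mset_eq_setD perms_def permutations_of_setD
        permutations_of_setI)
qed

lemma prefix_reversal_invol: "prefix_reversal t (prefix_reversal t xs) = xs"
  by (cases "t \<le> length xs") (auto simp: prefix_reversal_def min_def)

lemma suffix_reversal_invol: "suffix_reversal t (suffix_reversal t xs) = xs"
  by (cases "t - 1 \<le> length xs") (auto simp: suffix_reversal_def min_def)

lemma sym_reversal_rel: "sym (reversal_rel k)"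
proof (rule symI)
  fix \<pi> \<tau> assume "(\<pi>, \<tau>) \<in> reversal_rel k"
  then obtain t where t: "\<pi> \<in> perms k" "\<tau> \<in> perms k" "t \<in> {1..k}"
    "\<tau> = prefix_reversal t \<pi> \<or> \<tau> = suffix_reversal t \<pi>"
    by (auto simp: reversal_rel_def)
  then have "\<pi> = prefix_reversal t \<tau> \<or> \<pi> = suffix_reversal t \<tau>"
    by (auto simp: prefix_reversal_invol suffix_reversal_invol)
  with t show "(\<tau>, \<pi>) \<in> reversal_rel k"
    by (auto simp: reversal_rel_def)
qed

lemma pair_graph_reversal_graph: "pair_graph (reversal_graph k)"
proof
  have fin: "finite (perms k)" by (simp add: perms_def)
  then show "finite (pverts (reversal_graph k))" by (simp add: reversal_graph_def)
  have "parcs (reversal_graph k) \<subseteq> perms k \<times> perms k"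
    by (auto simp: reversal_graph_def reversal_rel_def)
  then show "finite (parcs (reversal_graph k))"
    using fin by (meson finite_SigmaI finite_subset)
  show "symmetric (with_proj (reversal_graph k))"
    using sym_reversal_rel[of k]
    by (auto simp: symmetric_def reversal_graph_def sym_def)
qed (auto simp: reversal_graph_def reversal_rel_def)

lemma graph_dist_reversal_graph:
  "graph_dist (with_proj (reversal_graph k)) \<pi> \<tau> =
    (INF p\<in>{p. pre_digraph.awalk (with_proj (reversal_graph k)) \<pi> p \<tau>}. ereal (real (length p)))"
proof -
  interpret pair_graph "reversal_graph k" by (rule pair_graph_reversal_graph)
  have "awalk_cost (\<lambda>_. 1) p = real (length p)" for p :: "(nat list \<times> nat list) list"
    by (induction p) auto
  then show ?thesis
    by (simp add: graph_dist_def \<mu>_def)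
qed

end

theory Submission
  imports Defs
begin

text \<open>
  Call two values adjacent if they differ by one modulo \<open>k\<close>, and cut the sequence into runs of
  consecutively adjacent values. Give a run weight 3/2 if it is a single entry and 2 otherwise (in
  the formal text, all weights are doubled). The weight starts at \<open>3k/2\<close>. As long as there is
  more than one run, some \<open>n\<close> reversals lower the weight by at least \<open>n\<close>:

  A run at one end of the sequence can be joined to the near end of another run by one reversal. If
  it has at least two entries, it can also be joined to the far end of a long run by two
  reversals, as two long runs weigh 4 together and merge to weight 2. In the remaining case, both
  ends are single entries \<open>x\<close> on the left and \<open>y\<close> on the right, and both neighbours of
  \<open>x\<close> are the right ends of long runs \<open>C\<close>, \<open>D\<close>, while both neighbours of \<open>y\<close> are the
  left ends of long runs \<open>E\<close>, \<open>F\<close>. If a run of \<open>y\<close> precedes or equals a run of \<open>x\<close>,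
  three reversals absorb \<open>x\<close> and \<open>y\<close>. Otherwise seven reversals merge all six runs into two,
  which also lowers the weight by seven.

  When a single run is left, the sequence is a rotation of the identity or of its reverse, and
  three more reversals finish.
\<close>

section \<open>Prefix and suffix reversals as block operations on lists\<close>

text \<open>Splitting into blocks avoids positions, so moves can be checked symbolically on
  concatenations; the arbitrary entry type permits relabelling.\<close>

definition end_reversals :: "'a list rel" where
  "end_reversals = {(xs, ys). \<exists>us vs. xs = us @ vs \<and> (ys = rev us @ vs \<or> ys = us @ rev vs)}"

lemma prefixI: "xs = us @ vs \<Longrightarrow> ys = rev us @ vs \<Longrightarrow> (xs, ys) \<in> end_reversals"
  by (auto simp: end_reversals_def)

lemma suffixI: "xs = us @ vs \<Longrightarrow> ys = us @ rev vs \<Longrightarrow> (xs, ys) \<in> end_reversals"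
  by (auto simp: end_reversals_def)

lemma end_reversals_mset: "(xs, ys) \<in> end_reversals \<Longrightarrow> mset ys = mset xs"
  by (auto simp: end_reversals_def)

lemma end_reversalsE:
  assumes "(xs, ys) \<in> end_reversals"
  obtains (pre) us vs where "xs = us @ vs" "ys = rev us @ vs"
  | (suf) us vs where "xs = us @ vs" "ys = us @ rev vs"
  using assms by (auto simp: end_reversals_def)

lemma end_reversals_map: "(xs, ys) \<in> end_reversals \<Longrightarrow> (map f xs, map f ys) \<in> end_reversals"
proof (elim end_reversalsE)
  fix us vs assume "xs = us @ vs" "ys = rev us @ vs"
  then show ?thesis by (intro prefixI[of _ "map f us" "map f vs"]) (simp_all add: rev_map)
next
  fix us vs assume "xs = us @ vs" "ys = us @ rev vs"
  then show ?thesis by (intro suffixI[of _ "map f us" "map f vs"]) (simp_all add: rev_map)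
qed

lemma end_reversals_rev: "(xs, ys) \<in> end_reversals \<Longrightarrow> (rev xs, rev ys) \<in> end_reversals"
proof (elim end_reversalsE)
  fix us vs assume "xs = us @ vs" "ys = rev us @ vs"
  then show ?thesis by (intro suffixI[of _ "rev vs" "rev us"]) simp_all
next
  fix us vs assume "xs = us @ vs" "ys = us @ rev vs"
  then show ?thesis by (intro prefixI[of _ "rev vs" "rev us"]) simp_all
qed

lemma relpow_image:
  assumes "\<And>x y. (x, y) \<in> r \<Longrightarrow> (f x, f y) \<in> s" "(x, y) \<in> r ^^ n"
  shows "(f x, f y) \<in> s ^^ n"
  using assms(2)
proof (induction n arbitrary: y)
  case (Suc n)
  then obtain z where "(x, z) \<in> r ^^ n" "(z, y) \<in> r" by auto
  with Suc.IH[of z] assms(1)[of z y] show ?case by auto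
qed auto

lemma end_reversals_relpow_mset:
  assumes "(xs, ys) \<in> end_reversals ^^ n"
  shows "mset ys = mset xs"
  using assms by (induction n arbitrary: ys) (auto dest: end_reversals_mset)

lemma end_reversal_in_reversal_rel:
  assumes "(xs, ys) \<in> end_reversals" "xs \<in> perms k" "k \<ge> 1"
  shows "(xs, ys) \<in> reversal_rel k"
proof -
  have len: "length xs = k" using assms(2) by (rule length_perms)
  \<comment> \<open>An empty reversed block would need an index \<open>t\<close> outside
    \<open>{1..k}\<close>; the trivial reversal with \<open>t = 1\<close> stands in for it.\<close>
  have triv: "(xs, xs) \<in> reversal_rel k"
  proof -
    have "prefix_reversal 1 xs = xs"
      by (cases xs) (auto simp: prefix_reversal_def)
    then show ?thesis
      using assms(2,3) unfolding reversal_rel_def by force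
  qed
  from assms(1) show ?thesis
  proof (cases rule: end_reversalsE)
    case (pre us vs)
    then have "ys = prefix_reversal (length us) xs" by (simp add: prefix_reversal_def)
    moreover have "length us \<in> {1..k}" if "us \<noteq> []"
      using pre len that by (cases us) auto
    ultimately show ?thesis
      using pre triv prefix_reversal_in_perms[OF assms(2), of "length us"] assms(2)
      by (cases "us = []") (simp, unfold reversal_rel_def, blast)
  next
    case (suf us vs)
    then have "ys = suffix_reversal (Suc (length us)) xs" by (simp add: suffix_reversal_def)
    moreover have "Suc (length us) \<in> {1..k}" if "vs \<noteq> []"
      using suf len that by (cases vs) auto
    ultimately show ?thesis
      using suf triv suffix_reversal_in_perms[OF assms(2), of "Suc (length us)"] assms(2)
      by (cases "vs = []") (simp, unfold reversal_rel_def, blast)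
  qed
qed

lemma end_reversals_relpow_in_reversal_rel:
  assumes "(xs, ys) \<in> end_reversals ^^ n" "xs \<in> perms k" "k \<ge> 1"
  shows "(xs, ys) \<in> reversal_rel k ^^ n"
  using assms
proof (induction n arbitrary: ys)
  case (Suc n)
  then obtain zs where zs: "(xs, zs) \<in> end_reversals ^^ n" "(zs, ys) \<in> end_reversals" by auto
  with Suc have "(xs, zs) \<in> reversal_rel k ^^ n" by blast
  moreover have "zs \<in> perms k"
    using end_reversals_relpow_mset[OF zs(1)] \<open>xs \<in> perms k\<close>
    by (metis mset_eq_imp_distinct_iff mset_eq_setD perms_def permutations_of_setD
        permutations_of_setI)
  ultimately show ?case
    using end_reversal_in_reversal_rel[OF zs(2)] \<open>k \<ge> 1\<close> by auto
qed auto

section \<open>Cyclic adjacency and the shape of runs\<close>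

text \<open>The values \<open>0..<k\<close> lie on a cycle rather than a path, so that
  \<open>0\<close> and \<open>k - 1\<close> also have two neighbours when
  \<open>k \<ge> 3\<close>.\<close>

definition up_step :: "nat \<Rightarrow> nat \<Rightarrow> nat \<Rightarrow> bool" where
  "up_step k a b \<longleftrightarrow> b = Suc a mod k"

definition adj :: "nat \<Rightarrow> nat \<Rightarrow> nat \<Rightarrow> bool" where
  "adj k a b \<longleftrightarrow> up_step k a b \<or> up_step k b a"

lemma adj_commute: "adj k a b \<longleftrightarrow> adj k b a"
  by (auto simp: adj_def)

lemma up_step_iff: "a < k \<Longrightarrow> up_step k a b \<longleftrightarrow> b = (if Suc a = k then 0 else Suc a)"
  by (auto simp: up_step_def)

lemma successively_adj_rev: "successively (adj k) (rev xs) \<longleftrightarrow> successively (adj k) xs"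
  by (subst successively_rev, rule successively_cong) (simp_all add: adj_commute)

lemma adj_neighbours:
  assumes "adj k v a" "adj k v b" "adj k v c" "a < k" "b < k" "c < k" "v < k"
  shows "a = b \<or> a = c \<or> b = c"
  using assms by (auto simp: adj_def up_step_iff split: if_splits)

lemma two_neighbours:
  assumes "x < k" "k \<ge> 3"
  obtains a b where "a < k" "b < k" "a \<noteq> b" "a \<noteq> x" "b \<noteq> x" "adj k x a" "adj k x b"
proof -
  let ?a = "if Suc x = k then 0 else Suc x" and ?b = "if x = 0 then k - 1 else x - 1"
  have "?a < k" "?b < k" "?a \<noteq> ?b" "?a \<noteq> x" "?b \<noteq> x" "adj k x ?a" "adj k x ?b"
    using assms by (auto simp: adj_def up_step_iff)
  then show ?thesis by (rule that)
qed

text \<open>An inner entry of \<open>q\<close> already has two cyclic neighbours beside it in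
  \<open>q\<close>; \<open>x\<close>, lying outside, would be a third.\<close>

lemma neighbour_at_end:
  assumes "successively (adj k) q" "distinct q" "set q \<subseteq> {..<k}"
    and "v \<in> set q" "x \<notin> set q" "x < k" "adj k x v"
  shows "v = hd q \<or> v = last q"
proof (rule ccontr)
  assume *: "\<not> ?thesis"
  obtain q1 q2 where q: "q = q1 @ v # q2" using \<open>v \<in> set q\<close> by (meson split_list)
  with * have "q1 \<noteq> []" "q2 \<noteq> []" by auto
  then obtain p1 a b p2 where "q1 = p1 @ [a]" "q2 = b # p2"
    by (metis neq_Nil_conv rev_exhaust)
  with q assms show False
    using adj_neighbours[of k v a b x] by (auto simp: successively_append_iff adj_commute)
qed

text \<open>A change of direction would return at once to the value just left, against
  distinctness.\<close>

lemma run_monotone: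
  assumes "successively (adj k) xs" "distinct xs" "set xs \<subseteq> {..<k}"
  shows "successively (up_step k) xs \<or> successively (up_step k) (rev xs)"
proof -
  have "successively (up_step k) xs \<or> successively (\<lambda>a b. up_step k b a) xs"
    using assms
  proof (induction xs rule: induct_list012)
    case (3 a b xs)
    then show ?case
      by (cases xs) (auto simp: adj_def up_step_iff split: if_splits)
  qed auto
  then show ?thesis by (simp add: successively_rev)
qed

text \<open>Only a step to \<open>0\<close> wraps around, so every step here adds one; a
  \<open>0\<close> at the head is harmless.\<close>

lemma up_run_avoiding_0:
  assumes "successively (up_step k) (a # xs)" "set (a # xs) \<subseteq> {..<k}" "0 \<notin> set xs"
  shows "a # xs = [a..<Suc a + length xs] \<and> Suc a + length xs \<le> k"
  using assms
proof (induction xs arbitrary: a)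
  case (Cons b xs)
  then have b: "b = Suc a" by (auto simp: up_step_iff split: if_splits)
  have IH: "b # xs = [b..<Suc b + length xs]" "Suc b + length xs \<le> k"
    using Cons.IH[of b] Cons.prems by auto
  have len: "Suc b + length xs = Suc a + length (b # xs)" using b by simp
  have "[a..<Suc b + length xs] = a # [b..<Suc b + length xs]"
    unfolding b by (rule upt_conv_Cons) simp
  also have "\<dots> = a # b # xs" by (subst IH(1)) (rule refl)
  finally show ?case using IH(2) unfolding len by simp
qed auto

text \<open>Distinctness allows at most one step to \<open>0\<close>, hence at most one wrap. Only a
  \<open>0\<close> in \<open>tl xs\<close> is reached by a step, so the split is made there.\<close>

lemma up_run_cases:
  assumes "successively (up_step k) xs" "set xs \<subseteq> {..<k}" "distinct xs" "xs \<noteq> []"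
  obtains (interval) a b where "a < b" "b \<le> k" "xs = [a..<b]"
  | (wrap) a n where "0 < n" "n \<le> a" "a < k" "xs = [a..<k] @ [0..<n]"
proof (cases "0 \<in> set (tl xs)")
  case False
  obtain a ys where xs: "xs = a # ys" using \<open>xs \<noteq> []\<close> by (cases xs) auto
  with False assms have "0 \<notin> set ys" by simp
  from up_run_avoiding_0[OF assms(1,2)[unfolded xs] this]
  have *: "a # ys = [a..<Suc a + length ys]" "Suc a + length ys \<le> k" by blast+
  show ?thesis
    by (rule interval[of a "Suc a + length ys"]) (simp, rule *(2), unfold xs, rule *(1))
next
  case True
  then obtain ps qs where xs: "xs = ps @ 0 # qs" "ps \<noteq> []"
    using \<open>xs \<noteq> []\<close> by (metis append_Cons list.collapse list.distinct(1) split_list)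
  have "successively (up_step k) (0 # qs)" "set (0 # qs) \<subseteq> {..<k}" "0 \<notin> set qs"
    using assms(1-3) unfolding xs(1) by (auto simp: successively_append_iff)
  from up_run_avoiding_0[OF this] have qs: "0 # qs = [0..<Suc (length qs)]" by simp
  obtain a ps' where ps: "ps = a # ps'" using xs by (cases ps) auto
  have ps_eq: "ps = [a..<Suc a + length ps']" "Suc a + length ps' \<le> k"
  proof -
    have "successively (up_step k) (a # ps')" "set (a # ps') \<subseteq> {..<k}" "0 \<notin> set ps'"
      using assms(1-3) unfolding xs(1) ps by (auto simp: successively_append_iff simp del: append_Cons)
    from up_run_avoiding_0[OF this] show "ps = [a..<Suc a + length ps']" "Suc a + length ps' \<le> k"
      unfolding ps by blast+
  qed
  \<comment> \<open>Only \<open>k - 1\<close> steps up to \<open>0\<close>, so the piece before the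
    wrap ends with it.\<close>
  have "up_step k (last ps) 0"
    using assms xs by (auto simp: successively_append_iff)
  moreover have "last ps = a + length ps'" by (subst ps_eq) simp
  ultimately have k: "Suc a + length ps' = k"
    using ps_eq(2) by (auto simp: up_step_iff split: if_splits)
  have "a \<notin> set (0 # qs)" using assms(3) xs(1) ps by auto
  then have "Suc (length qs) \<le> a" unfolding qs by simp
  moreover have "xs = [a..<k] @ [0..<Suc (length qs)]"
    using ps_eq(1) qs unfolding xs(1) k by (simp only:)
  ultimately show ?thesis
    using k by (intro wrap[of "Suc (length qs)" a]) auto
qed

text \<open>If a monotone run contained the value beyond its head, it would close the cycle and
  cover everything. A falling run is treated through its mirror image, where the head becomes the
  last entry.\<close>

lemma run_left_extension:
  assumes "successively (adj k) r" "distinct r" "set r \<subset> {..<k}" "r \<noteq> []"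
  shows "\<exists>v<k. v \<notin> set r \<and> adj k (hd r) v"
proof -
  have sub: "set r \<subseteq> {..<k}" "set r \<noteq> {..<k}" using assms by auto
  from run_monotone[OF assms(1,2) sub(1)] show ?thesis
  proof
    assume "successively (up_step k) r"
    then show ?thesis using sub(1) assms(2,4)
    proof (cases rule: up_run_cases)
      case (interval a b)
      with sub show ?thesis
        by (intro exI[of _ "if a = 0 then k - 1 else a - 1"])
          (auto simp: adj_def up_step_iff)
    next
      case (wrap a n)
      have "n \<noteq> a" using sub(2) wrap by auto
      with wrap show ?thesis
        by (intro exI[of _ "a - 1"]) (auto simp: adj_def up_step_iff)
    qed
  next
    assume up: "successively (up_step k) (rev r)"
    have "hd r = last (rev r)" using assms(4) by (simp add: last_rev)
    have cover: "set (rev r) \<noteq> {..<k}" using sub(2) by simp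
    have "set (rev r) \<subseteq> {..<k}" "distinct (rev r)" "rev r \<noteq> []"
      using assms by auto
    with up have "\<exists>v<k. v \<notin> set (rev r) \<and> adj k (last (rev r)) v"
    proof (cases rule: up_run_cases)
      case (interval a b)
      with cover show ?thesis
        by (intro exI[of _ "if b = k then 0 else b"]) (auto simp: adj_def up_step_iff)
    next
      case (wrap a n)
      have "n \<noteq> a" using cover wrap by auto
      with wrap show ?thesis
        by (intro exI[of _ n]) (auto simp: adj_def up_step_iff)
    qed
    with \<open>hd r = last (rev r)\<close> show ?thesis by simp
  qed
qed

text \<open>A rising complete run is a rotation \<open>B @ A\<close>: reversing \<open>B\<close>,
  then \<open>A\<close>, then the whole list gives \<open>A @ B\<close>. A falling one is
  \<open>rev A @ rev B\<close> and needs one reversal per block.\<close>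

lemma complete_run_sort:
  assumes "successively (adj k) xs" "distinct xs" "set xs = {..<k}" "k \<ge> 1"
  shows "\<exists>n\<le>3. (xs, [0..<k]) \<in> end_reversals ^^ n"
proof -
  have rot: "\<exists>a\<le>k. ys = [a..<k] @ [0..<a]"
    if "successively (up_step k) ys" "distinct ys" "set ys = {..<k}" for ys
  proof -
    have "set ys \<subseteq> {..<k}" using that(3) by simp
    have "0 \<in> set ys" using that(3) \<open>k \<ge> 1\<close> by simp
    then have "ys \<noteq> []" by (cases ys) simp_all
    from that(1) \<open>set ys \<subseteq> {..<k}\<close> that(2) this show ?thesis
    proof (cases rule: up_run_cases)
      case (interval a b)
      then have "{a..<b} = {..<k}" using that(3) by simp
      then have "0 \<in> {a..<b}" "k - 1 \<in> {a..<b}" using \<open>k \<ge> 1\<close> by simp_all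
      then have "a = 0" "b = k" using interval(2) by auto
      with interval show ?thesis by (intro exI[of _ 0]) simp
    next
      case (wrap a n)
      \<comment> \<open>Otherwise the value \<open>n\<close> would lie in the gap between the two
        pieces and be missing.\<close>
      have "\<not> n < a"
      proof
        assume "n < a"
        then have "n \<in> set ys" unfolding that(3) using wrap(3) by simp
        with wrap \<open>n < a\<close> show False by simp
      qed
      with wrap show ?thesis by (intro exI[of _ a]) simp
    qed
  qed
  have up: "[0..<k] = [0..<a] @ [a..<k]" if "a \<le> k" for a
    using upt_add_eq_append[of 0 a "k - a"] that by simp
  from run_monotone[of k xs] assms consider "successively (up_step k) xs"
    | "successively (up_step k) (rev xs)" by auto
  then show ?thesis
  proof cases
    case 1
    then obtain a where a: "a \<le> k" "xs = [a..<k] @ [0..<a]" using rot assms by blast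
    let ?A = "[0..<a]" and ?B = "[a..<k]"
    have "(?B @ ?A, rev ?B @ ?A) \<in> end_reversals" by (rule prefixI) auto
    moreover have "(rev ?B @ ?A, rev ?B @ rev ?A) \<in> end_reversals" by (rule suffixI) auto
    moreover have "(rev ?B @ rev ?A, ?A @ ?B) \<in> end_reversals"
      by (rule prefixI[of _ "rev ?B @ rev ?A" "[]"]) auto
    ultimately have "(?B @ ?A, ?A @ ?B) \<in> end_reversals ^^ 3"
      unfolding numeral_3_eq_3 by (blast intro: relpow_Suc_I relpow_0_I)
    then show ?thesis using a up[of a] by (intro exI[of _ 3]) simp
  next
    case 2
    then obtain a where a: "a \<le> k" "rev xs = [a..<k] @ [0..<a]"
      using rot[of "rev xs"] assms by auto
    let ?A = "[0..<a]" and ?B = "[a..<k]"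
    have xs: "xs = rev ?A @ rev ?B" using a(2) by (metis rev_append rev_rev_ident)
    have "(rev ?A @ rev ?B, ?A @ rev ?B) \<in> end_reversals" by (rule prefixI) auto
    moreover have "(?A @ rev ?B, ?A @ ?B) \<in> end_reversals" by (rule suffixI) auto
    ultimately have "(rev ?A @ rev ?B, ?A @ ?B) \<in> end_reversals ^^ 2"
      unfolding numeral_2_eq_2 by (blast intro: relpow_Suc_I relpow_0_I)
    then show ?thesis using xs a(1) up[of a] by (intro exI[of _ 2]) auto
  qed
qed

section \<open>Run partitions, their weight, and improvement\<close>

text \<open>Runs need not be maximal, so the partition into single entries is a valid start.\<close>

definition run_partition :: "nat \<Rightarrow> nat list list \<Rightarrow> bool" where
  "run_partition k R \<longleftrightarrow> (\<forall>r\<in>set R. r \<noteq> [] \<and> successively (adj k) r) \<and>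
     distinct (concat R) \<and> set (concat R) = {..<k}"

definition run_weight :: "nat list \<Rightarrow> nat" where
  "run_weight r = (if length r = 1 then 3 else 4)"

definition weight :: "nat list list \<Rightarrow> nat" where
  "weight R = sum_list (map run_weight R)"

definition reverse_runs :: "'a list list \<Rightarrow> 'a list list" where
  "reverse_runs R = map rev (rev R)"

text \<open>The falling number of runs drives the induction; the drop in doubled weight pays two
  units for each reversal.\<close>

definition improvable :: "nat \<Rightarrow> nat list list \<Rightarrow> bool" where
  "improvable k R \<longleftrightarrow> (\<exists>n R'. run_partition k R' \<and> length R' < length R \<and>
     weight R' + 2 * n \<le> weight R \<and> (concat R, concat R') \<in> end_reversals ^^ n)"

lemma weight_simps [simp]:
  "weight [] = 0" "weight (r # R) = run_weight r + weight R" "weight (R @ S) = weight R + weight S"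
  by (simp_all add: weight_def)

lemma run_weight_rev [simp]: "run_weight (rev r) = run_weight r"
  by (simp add: run_weight_def)

lemma run_weight_bounds: "3 \<le> run_weight r" "run_weight r \<le> 4"
  by (simp_all add: run_weight_def)

lemma run_weight_long: "2 \<le> length r \<Longrightarrow> run_weight r = 4"
  by (simp add: run_weight_def)

lemma reverse_runs_simps [simp]:
  "reverse_runs [] = []" "reverse_runs (r # R) = reverse_runs R @ [rev r]"
  "reverse_runs (R @ S) = reverse_runs S @ reverse_runs R"
  "length (reverse_runs R) = length R" "set (reverse_runs R) = rev ` set R"
  "concat (reverse_runs R) = rev (concat R)" "reverse_runs (reverse_runs R) = R"
  by (simp_all add: reverse_runs_def rev_concat rev_map o_def)

lemma weight_reverse_runs [simp]: "weight (reverse_runs R) = weight R"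
  by (induction R) simp_all

lemma run_partition_reverse_runs [simp]: "run_partition k (reverse_runs R) \<longleftrightarrow> run_partition k R"
  by (simp add: run_partition_def successively_adj_rev del: successively_rev)

text \<open>Reversals only permute entries, so distinctness and coverage carry over and only the new
  runs need checking.\<close>

lemma improvableI:
  assumes "run_partition k R" "(concat R, concat R') \<in> end_reversals ^^ n"
    and "\<And>r. r \<in> set R' \<Longrightarrow> r \<noteq> [] \<and> successively (adj k) r"
    and "length R' < length R" "weight R' + 2 * n \<le> weight R"
  shows "improvable k R"
proof -
  have "mset (concat R') = mset (concat R)"
    using assms(2) by (rule end_reversals_relpow_mset)
  then have "distinct (concat R') = distinct (concat R)" "set (concat R') = set (concat R)"
    by (rule mset_eq_imp_distinct_iff, rule mset_eq_setD)
  then have "run_partition k R'" using assms(1,3) unfolding run_partition_def by blast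
  then show ?thesis using assms unfolding improvable_def by blast
qed

text \<open>Mirroring exchanges prefix and suffix reversals, so results on the left end apply to the
  right end.\<close>

lemma improvable_reverse_runs:
  assumes "improvable k (reverse_runs R)"
  shows "improvable k R"
proof -
  from assms obtain n R' where R': "run_partition k R'" "length R' < length R"
    "weight R' + 2 * n \<le> weight R" "(rev (concat R), concat R') \<in> end_reversals ^^ n"
    by (auto simp: improvable_def)
  have "(rev (rev (concat R)), rev (concat R')) \<in> end_reversals ^^ n"
    using end_reversals_rev R'(4) by (rule relpow_image)
  then have "(concat R, concat (reverse_runs R')) \<in> end_reversals ^^ n"
    by simp
  with R' show ?thesis
    unfolding improvable_def by (intro exI[of _ n] exI[of _ "reverse_runs R'"]) simp
qed

section \<open>The improving moves\<close>

lemma relpow_prefix: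
  "(rev us @ vs, ys) \<in> end_reversals ^^ n \<Longrightarrow> (us @ vs, ys) \<in> end_reversals ^^ Suc n"
  by (rule relpow_Suc_I2[rotated]) (auto intro: prefixI)

lemma relpow_suffix:
  "(us @ rev vs, ys) \<in> end_reversals ^^ n \<Longrightarrow> (us @ vs, ys) \<in> end_reversals ^^ Suc n"
  by (rule relpow_Suc_I2[rotated]) (auto intro: suffixI)

text \<open>A join at \<open>hd q\<close> costs 2 units and frees at least \<open>3 + 3 - 4\<close>.
  A join at \<open>last q\<close> costs 4 and needs both runs long, freeing
  \<open>4 + 4 - 4\<close>.\<close>

lemma improve_left_end:
  assumes v: "run_partition k (r # R)" and q: "q \<in> set R"
    and "adj k (hd r) (hd q) \<or> 2 \<le> length r \<and> adj k (hd r) (last q)"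
  shows "improvable k (r # R)"
proof -
  obtain A B where R: "R = A @ q # B" using q by (meson split_list)
  let ?a = "concat A" and ?b = "concat B"
  have runs: "s \<noteq> [] \<and> successively (adj k) s" if "s \<in> set A \<union> set B \<union> {r, q}" for s
    using v that unfolding run_partition_def R by auto
  note w = run_weight_bounds[of r] run_weight_bounds[of q]
    run_weight_bounds[of "rev r @ q"] run_weight_bounds[of "rev r @ rev q"]
  show ?thesis
  proof (cases "adj k (hd r) (hd q)")
    case True
    have "((r @ ?a) @ q @ ?b, rev ?a @ rev r @ q @ ?b) \<in> end_reversals ^^ 1"
      unfolding One_nat_def by (rule relpow_prefix) simp
    then have "(concat (r # R), concat (reverse_runs A @ (rev r @ q) # B)) \<in> end_reversals ^^ 1"
      unfolding R by simp
    then show ?thesis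
    proof (rule improvableI[OF v])
      fix s assume "s \<in> set (reverse_runs A @ (rev r @ q) # B)"
      then show "s \<noteq> [] \<and> successively (adj k) s"
        using runs True
          by (auto simp: successively_adj_rev successively_append_iff last_rev
              simp del: successively_rev)
    qed (use w in \<open>simp_all add: R\<close>)
  next
    case False
    with assms(3) have *: "2 \<le> length r" "adj k (hd r) (last q)" by auto
    \<comment> \<open>\<open>last q\<close> is adjacent to \<open>hd r\<close> but
      \<open>hd q\<close> is not, so \<open>q\<close> is long too.\<close>
    have "hd q \<noteq> last q" using False * by auto
    then have "2 \<le> length q" using runs[of q] by (cases q; cases "tl q") auto
    \<comment> \<open>The chain is built backwards: first the prefix reversal that brings
      \<open>hd r\<close> next to \<open>last q\<close>, then the suffix reversal before it that
      turns \<open>q\<close> around.\<close>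
    have "((r @ ?a @ rev ?b) @ rev q, ?b @ rev ?a @ rev r @ rev q) \<in> end_reversals ^^ 1"
      unfolding One_nat_def by (rule relpow_prefix) simp
    then have "((r @ ?a) @ rev (q @ ?b), ?b @ rev ?a @ rev r @ rev q) \<in> end_reversals ^^ 1"
      by simp
    then have "((r @ ?a) @ (q @ ?b), ?b @ rev ?a @ rev r @ rev q) \<in> end_reversals ^^ Suc 1"
      by (rule relpow_suffix)
    then have "(concat (r # R), concat (B @ reverse_runs A @ [rev r @ rev q])) \<in> end_reversals ^^ 2"
      unfolding R by (simp add: numeral_2_eq_2)
    then show ?thesis
    proof (rule improvableI[OF v])
      fix s assume "s \<in> set (B @ reverse_runs A @ [rev r @ rev q])"
      then show "s \<noteq> [] \<and> successively (adj k) s"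
        using runs * by (auto simp: successively_adj_rev successively_append_iff last_rev hd_rev
            simp del: successively_rev)
    qed (use w run_weight_long[OF *(1)] run_weight_long[OF \<open>2 \<le> length q\<close>]
      in \<open>simp_all add: R\<close>)
  qed
qed

text \<open>Both single entries are attached to \<open>S\<close>; the weight falls from
  \<open>3 + 4 + 3\<close> to \<open>4\<close>, exactly the 6 units for three reversals.\<close>

lemma improve_shared:
  assumes v: "run_partition k ([x] # U @ S # V @ [[y]])" and "2 \<le> length S"
    and "adj k x (last S)" "adj k y (hd S)"
  shows "improvable k ([x] # U @ S # V @ [[y]])"
proof -
  let ?u = "concat U" and ?v = "concat V"
  let ?R' = "V @ [[y] @ S @ [x]] @ U"
  have runs: "s \<noteq> [] \<and> successively (adj k) s" if "s \<in> set U \<union> set V \<union> {S}" for s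
    using v that unfolding run_partition_def by auto
  have "(([x] @ ?u @ S) @ (?v @ [y]), rev S @ rev ?u @ [x] @ ?v @ [y]) \<in> end_reversals"
    by (rule prefixI[of _ "[x] @ ?u @ S"], simp, simp)
  moreover have "(rev S @ rev ?u @ [x] @ ?v @ [y], rev S @ [y] @ rev ?v @ [x] @ ?u) \<in> end_reversals"
    by (rule suffixI[of _ "rev S"], simp, simp)
  moreover have "(rev S @ [y] @ rev ?v @ [x] @ ?u, ?v @ [y] @ S @ [x] @ ?u) \<in> end_reversals"
    by (rule prefixI[of _ "rev S @ [y] @ rev ?v"], simp, simp)
  ultimately have "(([x] @ ?u @ S) @ (?v @ [y]), ?v @ [y] @ S @ [x] @ ?u) \<in> end_reversals ^^ 3"
    unfolding numeral_3_eq_3 by (blast intro: relpow_Suc_I relpow_0_I)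
  then have "(concat ([x] # U @ S # V @ [[y]]), concat ?R') \<in> end_reversals ^^ 3" by simp
  then show ?thesis
  proof (rule improvableI[OF v])
    fix s assume "s \<in> set ?R'"
    then show "s \<noteq> [] \<and> successively (adj k) s"
      using runs assms(3,4) by (auto simp: successively_append_iff successively_Cons adj_commute)
  qed (use assms(2) in \<open>simp_all add: run_weight_def\<close>)
qed

text \<open>The moves of \<open>improve_shared\<close> with the whole stretch from \<open>E\<close>
  to \<open>C\<close> in the role of \<open>S\<close>: \<open>y\<close> meets its front,
  \<open>x\<close> its rear. The four runs fall from weight 14 to 8.\<close>

lemma improve_crossing:
  assumes v: "run_partition k ([x] # U @ E # V @ C # W @ [[y]])" and "2 \<le> length C" "2 \<le> length E"
    and "adj k x (last C)" "adj k y (hd E)"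
  shows "improvable k ([x] # U @ E # V @ C # W @ [[y]])"
proof -
  let ?u = "concat U" and ?v = "concat V" and ?w = "concat W"
  let ?R' = "W @ [[y] @ E] @ V @ [C @ [x]] @ U"
  have runs: "s \<noteq> [] \<and> successively (adj k) s" if "s \<in> set U \<union> set V \<union> set W \<union> {C, E}" for s
    using v that unfolding run_partition_def by auto
  have "(([x] @ ?u @ E @ ?v @ C) @ (?w @ [y]), rev C @ rev ?v @ rev E @ rev ?u @ [x] @ ?w @ [y])
    \<in> end_reversals"
    by (rule prefixI[of _ "[x] @ ?u @ E @ ?v @ C"], simp, simp)
  moreover have "(rev C @ rev ?v @ rev E @ rev ?u @ [x] @ ?w @ [y],
    rev C @ rev ?v @ rev E @ [y] @ rev ?w @ [x] @ ?u) \<in> end_reversals"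
    by (rule suffixI[of _ "rev C @ rev ?v @ rev E"], simp, simp)
  moreover have "(rev C @ rev ?v @ rev E @ [y] @ rev ?w @ [x] @ ?u,
    ?w @ [y] @ E @ ?v @ C @ [x] @ ?u) \<in> end_reversals"
    by (rule prefixI[of _ "rev C @ rev ?v @ rev E @ [y] @ rev ?w"], simp, simp)
  ultimately have "(([x] @ ?u @ E @ ?v @ C) @ (?w @ [y]), ?w @ [y] @ E @ ?v @ C @ [x] @ ?u)
    \<in> end_reversals ^^ 3"
    unfolding numeral_3_eq_3 by (blast intro: relpow_Suc_I relpow_0_I)
  then have "(concat ([x] # U @ E # V @ C # W @ [[y]]), concat ?R') \<in> end_reversals ^^ 3" by simp
  then show ?thesis
  proof (rule improvableI[OF v])
    fix s assume "s \<in> set ?R'"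
    then show "s \<noteq> [] \<and> successively (adj k) s"
      using runs assms(4,5) by (auto simp: successively_append_iff successively_Cons adj_commute)
  qed (use assms(2,3) in \<open>simp_all add: run_weight_def\<close>)
qed

text \<open>\<open>x\<close> ends up between \<open>D\<close> and \<open>C\<close>, \<open>y\<close>
  between \<open>F\<close> and \<open>E\<close>; six runs of weight 22 become two of weight 8,
  exactly 14 units for seven reversals. The second, fifth, sixth and seventh reversals make the four
  joins, the others prepare them.\<close>

lemma improve_separated:
  assumes v: "run_partition k ([x] # U @ C # V @ D # W @ E # Z @ F # T @ [[y]])" (is "run_partition k ?R")
    and long: "2 \<le> length C" "2 \<le> length D" "2 \<le> length E" "2 \<le> length F"
    and "adj k x (last C)" "adj k x (last D)" "adj k y (hd E)" "adj k y (hd F)"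
  shows "improvable k ?R"
proof -
  let ?u = "concat U" and ?v = "concat V" and ?w = "concat W" and ?z = "concat Z" and ?t = "concat T"
  let ?R' = "reverse_runs W @ V @ [D @ [x] @ rev C] @ reverse_runs U @ reverse_runs T @
    [rev F @ [y] @ E] @ Z"
  have runs: "\<forall>s\<in>set U \<union> set V \<union> set W \<union> set Z \<union> set T. s \<noteq> [] \<and> successively (adj k) s"
    and ends: "C \<noteq> []" "D \<noteq> []" "E \<noteq> []" "F \<noteq> []" "successively (adj k) C"
      "successively (adj k) D" "successively (adj k) E" "successively (adj k) F"
    using v unfolding run_partition_def by simp_all
  have joined: "successively (adj k) (D @ [x] @ rev C)" "successively (adj k) (rev F @ [y] @ E)"
    using ends assms(6-9)
    by (simp_all add: successively_append_iff successively_Cons successively_adj_rev adj_commute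
        hd_rev last_rev del: successively_rev)
  \<comment> \<open>The intermediate sequences come from a computer search over the arrangements and orientations
    of the eleven blocks \<open>x\<close>, \<open>U\<close>, \<open>C\<close>, \<open>V\<close>, \<open>D\<close>, \<open>W\<close>, \<open>E\<close>, \<open>Z\<close>, \<open>F\<close>, \<open>T\<close>, \<open>y\<close>.\<close>
  define l0 where "l0 = [x] @ ?u @ C @ ?v @ D @ ?w @ E @ ?z @ F @ ?t @ [y]"
  define l1 where "l1 = [x, y] @ rev ?t @ rev F @ rev ?z @ rev E @ rev ?w @ rev D @ rev ?v @
    rev C @ rev ?u"
  define l2 where "l2 = ?w @ E @ ?z @ F @ ?t @ [y, x] @ rev D @ rev ?v @ rev C @ rev ?u"
  define l3 where "l3 = ?w @ E @ ?z @ F @ ?t @ ?u @ C @ ?v @ D @ [x, y]"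
  define l4 where "l4 = rev C @ rev ?u @ rev ?t @ rev F @ rev ?z @ rev E @ rev ?w @ ?v @ D @ [x, y]"
  define l5 where "l5 = rev C @ rev ?u @ rev ?t @ rev F @ [y, x] @ rev D @ rev ?v @ ?w @ E @ ?z"
  define l6 where "l6 = [y] @ F @ ?t @ ?u @ C @ [x] @ rev D @ rev ?v @ ?w @ E @ ?z"
  define l7 where "l7 = rev ?w @ ?v @ D @ [x] @ rev C @ rev ?u @ rev ?t @ rev F @ [y] @ E @ ?z"
  note defs = l0_def l1_def l2_def l3_def l4_def l5_def l6_def l7_def
  have s1: "(l0, l1) \<in> end_reversals"
    by (rule suffixI[of _ "[x]"],
        simp add: defs, simp add: defs)
  have s2: "(l1, l2) \<in> end_reversals"
    by (rule prefixI[of _ "[x, y] @ rev ?t @ rev F @ rev ?z @ rev E @ rev ?w"],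
        simp add: defs, simp add: defs)
  have s3: "(l2, l3) \<in> end_reversals"
    by (rule suffixI[of _ "?w @ E @ ?z @ F @ ?t"],
        simp add: defs, simp add: defs)
  have s4: "(l3, l4) \<in> end_reversals"
    by (rule prefixI[of _ "?w @ E @ ?z @ F @ ?t @ ?u @ C"],
        simp add: defs, simp add: defs)
  have s5: "(l4, l5) \<in> end_reversals"
    by (rule suffixI[of _ "rev C @ rev ?u @ rev ?t @ rev F"],
        simp add: defs, simp add: defs)
  have s6: "(l5, l6) \<in> end_reversals"
    by (rule prefixI[of _ "rev C @ rev ?u @ rev ?t @ rev F @ [y]"],
        simp add: defs, simp add: defs)
  have s7: "(l6, l7) \<in> end_reversals"
    by (rule prefixI[of _ "[y] @ F @ ?t @ ?u @ C @ [x] @ rev D @ rev ?v @ ?w"],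
        simp add: defs, simp add: defs)
  have "(l0, l7) \<in> end_reversals ^^ Suc (Suc (Suc (Suc (Suc (Suc (Suc 0))))))"
    by (rule relpow_Suc_I2, rule s1, rule relpow_Suc_I2, rule s2, rule relpow_Suc_I2, rule s3,
        rule relpow_Suc_I2, rule s4, rule relpow_Suc_I2, rule s5, rule relpow_Suc_I2, rule s6,
        rule relpow_Suc_I2, rule s7, rule relpow_0_I)
  then have "(concat ?R, concat ?R') \<in> end_reversals ^^ 7"
    by (simp add: l0_def l7_def numeral_eq_Suc del: relpow.simps)
  then show ?thesis
  proof (rule improvableI[OF v])
    fix s assume "s \<in> set ?R'"
    then consider "rev s \<in> set U \<union> set W \<union> set T" | "s \<in> set V \<union> set Z"
      | "s = D @ [x] @ rev C" | "s = rev F @ [y] @ E"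
      by auto
    then show "s \<noteq> [] \<and> successively (adj k) s"
    proof cases
      case 1
      with runs have "rev s \<noteq> [] \<and> successively (adj k) (rev s)" by blast
      then show ?thesis unfolding successively_adj_rev by simp
    qed (use runs joined in \<open>blast, simp_all\<close>)
  qed (use long in \<open>simp_all add: run_weight_def\<close>)
qed

section \<open>Existence of an improving move\<close>

lemma run_partition_run:
  assumes "run_partition k R" "q \<in> set R"
  shows "q \<noteq> []" "successively (adj k) q" "distinct q" "set q \<subseteq> {..<k}"
proof -
  obtain A B where "R = A @ q # B" using assms(2) by (meson split_list)
  with assms(1) show "q \<noteq> []" "successively (adj k) q" "distinct q" "set q \<subseteq> {..<k}"
    by (auto simp: run_partition_def)
qed

lemma run_partition_disjoint:
  assumes "run_partition k (r # R)" "q \<in> set R"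
  shows "set r \<inter> set q = {}"
  using assms by (auto simp: run_partition_def)

text \<open>The cyclic neighbour of \<open>hd r\<close> beyond \<open>r\<close> lies in another run,
  and by \<open>neighbour_at_end\<close> at one of its ends.\<close>

lemma long_run_neighbour:
  assumes "run_partition k (r # R)" "R \<noteq> []" "2 \<le> length r"
  shows "\<exists>q\<in>set R. adj k (hd r) (hd q) \<or> adj k (hd r) (last q)"
proof -
  have r: "successively (adj k) r" "distinct r" "set r \<subseteq> {..<k}" "r \<noteq> []"
    and cover: "set r \<union> set (concat R) = {..<k}"
    using assms(1) run_partition_run[OF assms(1), of r] by (simp_all add: run_partition_def)
  have runs: "q \<noteq> [] \<and> successively (adj k) q \<and> distinct q \<and> set q \<subseteq> {..<k}"
    if "q \<in> set R" for q
    using run_partition_run[OF assms(1)] that by simp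
  obtain q where "q \<in> set R" using assms(2) by (cases R) auto
  with runs have "hd q \<in> set q" "hd q < k" using hd_in_set[of q] by blast+
  moreover from this have "hd q \<notin> set r"
    using run_partition_disjoint[OF assms(1) \<open>q \<in> set R\<close>] by blast
  ultimately have "set r \<subset> {..<k}" using r(3) by blast
  then obtain v where v: "v < k" "v \<notin> set r" "adj k (hd r) v"
    using run_left_extension[OF r(1,2) _ r(4)] by blast
  with cover have "v \<in> set (concat R)" by blast
  then obtain p where p: "p \<in> set R" "v \<in> set p" by auto
  have "hd r \<in> set r" using r(4) by simp
  then have "hd r \<notin> set p" "hd r < k"
    using run_partition_disjoint[OF assms(1) p(1)] r(3) by auto
  then have "v = hd p \<or> v = last p"
    using neighbour_at_end[of k p v "hd r"] runs[OF p(1)] p(2) v(3) by blast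
  with p(1) v(3) show ?thesis by blast
qed

text \<open>Both cyclic neighbours of \<open>x\<close> are ends of other runs, but not heads by
  \<open>no\<close>; being last and not first, each belongs to a long run. The neighbours differ,
  hence so do the runs.\<close>

lemma single_run_neighbours:
  assumes "run_partition k ([x] # R)" "3 \<le> k" and no: "\<not> (\<exists>q\<in>set R. adj k x (hd q))"
  shows "\<exists>C\<in>set R. \<exists>D\<in>set R. C \<noteq> D \<and> 2 \<le> length C \<and> 2 \<le> length D \<and>
    adj k x (last C) \<and> adj k x (last D)"
proof -
  have cover: "insert x (set (concat R)) = {..<k}"
    using assms(1) by (simp add: run_partition_def)
  have runs: "q \<noteq> [] \<and> successively (adj k) q \<and> distinct q \<and> set q \<subseteq> {..<k}"
    if "q \<in> set R" for q
    using run_partition_run[OF assms(1)] that by simp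
  have "x < k" using cover by (metis insertI1 lessThan_iff)
  have ext: "\<exists>q\<in>set R. last q = v \<and> 2 \<le> length q" if "v < k" "v \<noteq> x" "adj k x v" for v
  proof -
    have "v \<in> insert x (set (concat R))" unfolding cover using that(1) by simp
    with that(2) have "v \<in> set (concat R)" by simp
    then obtain q where q: "q \<in> set R" "v \<in> set q" by auto
    have "x \<notin> set q" using run_partition_disjoint[OF assms(1) q(1)] by simp
    then have "v = hd q \<or> v = last q"
      using neighbour_at_end[of k q v x] runs[OF q(1)] q(2) that(3) \<open>x < k\<close> by blast
    moreover have "v \<noteq> hd q" using no q(1) that(3) by blast
    ultimately have "v = last q" "hd q \<noteq> last q" by simp_all
    moreover have "2 \<le> length q"
      using q(2) \<open>hd q \<noteq> last q\<close> by (cases q; cases "tl q") simp_all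
    ultimately show ?thesis using q(1) by (intro bexI[of _ q]) simp_all
  qed
  obtain a b where ab: "a < k" "b < k" "a \<noteq> b" "a \<noteq> x" "b \<noteq> x" "adj k x a" "adj k x b"
    using two_neighbours[OF \<open>x < k\<close> assms(2)] .
  obtain C where C: "C \<in> set R" "last C = a" "2 \<le> length C" using ext[OF ab(1,4,6)] by blast
  obtain D where D: "D \<in> set R" "last D = b" "2 \<le> length D" using ext[OF ab(2,5,7)] by blast
  show ?thesis
    by (rule bexI[OF _ C(1)], rule bexI[OF _ D(1)]) (use C D ab in \<open>simp, blast\<close>)
qed

text \<open>For a long run at the left end, \<open>long_run_neighbour\<close> offers a join and
  \<open>improve_left_end\<close> performs it. A single entry that no head can take falls under
  \<open>single_run_neighbours\<close>.\<close>

lemma single_end_if_not_improvable: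
  assumes "run_partition k R" "2 \<le> length R" "3 \<le> k" "\<not> improvable k R"
  obtains x R' where "R = [x] # R'"
    and "\<exists>C\<in>set R'. \<exists>D\<in>set R'. C \<noteq> D \<and> 2 \<le> length C \<and> 2 \<le> length D \<and>
      adj k x (last C) \<and> adj k x (last D)"
proof -
  obtain r R' where R: "R = r # R'" "R' \<noteq> []"
    using assms(2) by (cases R; cases "tl R") auto
  have "r \<noteq> []" using assms(1) R by (auto simp: run_partition_def)
  have no: "\<not> (\<exists>q\<in>set R'. adj k (hd r) (hd q) \<or> 2 \<le> length r \<and> adj k (hd r) (last q))"
    using improve_left_end assms(1,4) unfolding R(1) by blast
  with long_run_neighbour[of k r R'] assms(1) R have "\<not> 2 \<le> length r" by blast
  with \<open>r \<noteq> []\<close> obtain x where r: "r = [x]" by (cases r; cases "tl r") auto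
  with single_run_neighbours[of k x R'] assms(1,3) no R show ?thesis by (intro that[of x R']) auto
qed

lemma split_list_two:
  assumes "a \<in> set xs" "b \<in> set xs" "a \<noteq> b"
  shows "(\<exists>us vs ws. xs = us @ a # vs @ b # ws) \<or> (\<exists>us vs ws. xs = us @ b # vs @ a # ws)"
proof -
  obtain us vs where xs: "xs = us @ a # vs" using assms(1) by (meson split_list)
  with assms consider "b \<in> set us" | "b \<in> set vs" by auto
  then show ?thesis
  proof cases
    case 1
    then obtain us1 us2 where "us = us1 @ b # us2" by (meson split_list)
    with xs show ?thesis by (intro disjI2 exI[of _ us1] exI[of _ us2] exI[of _ vs]) simp
  next
    case 2
    then obtain vs1 vs2 where "vs = vs1 @ b # vs2" by (meson split_list)
    with xs show ?thesis by blast
  qed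
qed

text \<open>Serves to name two elements by their order of occurrence without loss of
  generality.\<close>

lemma split_list_two_symmetric:
  assumes "a \<in> set xs" "b \<in> set xs" "a \<noteq> b" "P a b" "P b a"
  obtains c d us vs ws where "xs = us @ c # vs @ d # ws" "P c d"
  using split_list_two[OF assms(1-3)] assms(4,5) by blast

lemma improve:
  assumes v: "run_partition k R" and "2 \<le> length R" "3 \<le> k"
  shows "improvable k R"
proof (rule ccontr)
  assume no: "\<not> improvable k R"
  obtain x R1 where R1: "R = [x] # R1"
    "\<exists>C\<in>set R1. \<exists>D\<in>set R1. C \<noteq> D \<and> 2 \<le> length C \<and> 2 \<le> length D \<and>
      adj k x (last C) \<and> adj k x (last D)"
    using single_end_if_not_improvable[OF assms no] .
  \<comment> \<open>The same analysis of the mirrored partition describes the right end.\<close>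
  have no': "\<not> improvable k (reverse_runs R)"
    using no improvable_reverse_runs by blast
  obtain y R2 where R2: "reverse_runs R = [y] # R2"
    "\<exists>C\<in>set R2. \<exists>D\<in>set R2. C \<noteq> D \<and> 2 \<le> length C \<and> 2 \<le> length D \<and>
      adj k y (last C) \<and> adj k y (last D)"
    by (rule single_end_if_not_improvable[of k "reverse_runs R"]) (use assms no' in auto)
  have "R = reverse_runs ([y] # R2)" using R2(1) by (metis reverse_runs_simps(7))
  then have R: "R = reverse_runs R2 @ [[y]]" by simp
  then obtain M where M: "R1 = M @ [[y]]" "reverse_runs R2 = [x] # M"
    using R1 by (cases "reverse_runs R2") auto
  have "R2 = reverse_runs ([x] # M)" using M(2) by (metis reverse_runs_simps(7))
  then have R2_eq: "R2 = reverse_runs M @ [[x]]" by simp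
  have R_eq: "R = [x] # M @ [[y]]" using R1 M by simp
  have nonempty: "r \<noteq> []" if "r \<in> set M" for r
    using v that unfolding R_eq run_partition_def by auto
  define wx where "wx C \<longleftrightarrow> 2 \<le> length C \<and> adj k x (last C)" for C
  define wy where "wy E \<longleftrightarrow> 2 \<le> length E \<and> adj k y (hd E)" for E
  obtain C D where CD: "C \<in> set M" "D \<in> set M" "C \<noteq> D" "wx C" "wx D"
    using R1(2) unfolding M(1) wx_def by auto
  \<comment> \<open>Mirroring turns each run around, so \<open>last\<close> in \<open>R2\<close>
    becomes \<open>hd\<close> in \<open>M\<close>; the length bound excludes
    \<open>[x]\<close>.\<close>
  obtain E F where EF: "E \<in> set M" "F \<in> set M" "E \<noteq> F" "wy E" "wy F"
    using R2(2) nonempty unfolding R2_eq wy_def by (auto simp: last_rev)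
  have no_shared: "\<not> (wx S \<and> wy S)" if "M = U @ S # V" for U S V
    using improve_shared[of k x U S V y] v no that unfolding R_eq wx_def wy_def by auto
  have no_crossing: "\<not> (wy S \<and> wx T)" if "M = U @ S # V @ T # W" for U S V T W
    using improve_crossing[of k x U S V T W y] v no that unfolding R_eq wx_def wy_def by auto
  obtain C' D' U V W where CD': "M = U @ C' # V @ D' # W" "wx C' \<and> wx D'"
    by (rule split_list_two_symmetric[of C M D "\<lambda>C D. wx C \<and> wx D"]) (use CD in auto)
  \<comment> \<open>A run of \<open>y\<close> equal to \<open>D'\<close> would be shared, and one
    before \<open>D'\<close>, possibly \<open>C'\<close> itself, would cross with \<open>D'\<close>.
    So the runs of \<open>y\<close> follow both runs of \<open>x\<close>.\<close>
  have after: "E \<in> set W" if "E \<in> set M" "wy E" for E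
  proof -
    have "E \<noteq> D'" using no_shared[of "U @ C' # V" D' W] CD' that by auto
    moreover have "E \<notin> set (U @ C' # V)"
    proof
      assume "E \<in> set (U @ C' # V)"
      then obtain U1 U2 where "U @ C' # V = U1 @ E # U2" by (meson split_list)
      then have "M = U1 @ E # U2 @ D' # W" using CD'(1) by (metis append_Cons append_assoc)
      then show False using no_crossing CD'(2) that(2) by blast
    qed
    ultimately show ?thesis using that(1) CD'(1) by auto
  qed
  obtain E' F' W' Z T where EF': "W = W' @ E' # Z @ F' # T" "wy E' \<and> wy F'"
    by (rule split_list_two_symmetric[of E W F "\<lambda>E F. wy E \<and> wy F"]) (use EF after in auto)
  have "R = [x] # U @ C' # V @ D' # W' @ E' # Z @ F' # T @ [[y]]"
    unfolding R_eq CD'(1) EF'(1) by simp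
  then show False
    using improve_separated[of k x U C' V D' W' E' Z F' T y] v no CD'(2) EF'(2)
    unfolding wx_def wy_def by blast
qed

section \<open>Sorting by repeated improvement\<close>

text \<open>The extra 3 pays for the end: the last run weighs at least 3, and together these 6 units
  cover three reversals.\<close>

lemma sort_runs:
  assumes "run_partition k R" "3 \<le> k"
  shows "\<exists>n. 2 * n \<le> weight R + 3 \<and> (concat R, [0..<k]) \<in> end_reversals ^^ n"
  using assms(1)
proof (induction "length R" arbitrary: R rule: less_induct)
  case less
  show ?case
  proof (cases "2 \<le> length R")
    case True
    with improve[OF less.prems _ assms(2)] obtain m R' where R': "run_partition k R'" "length R' < length R"
      "weight R' + 2 * m \<le> weight R" "(concat R, concat R') \<in> end_reversals ^^ m"
      by (auto simp: improvable_def)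
    with less.hyps obtain n where "2 * n \<le> weight R' + 3" "(concat R', [0..<k]) \<in> end_reversals ^^ n"
      by blast
    with R' show ?thesis
      by (intro exI[of _ "m + n"]) (auto simp: relpow_add)
  next
    case False
    have "0 \<in> set (concat R)" using less.prems assms(2) by (auto simp: run_partition_def)
    with False obtain r where R: "R = [r]" by (cases R; cases "tl R") auto
    with less.prems complete_run_sort[of k r] assms(2) obtain n
      where "n \<le> 3" "(r, [0..<k]) \<in> end_reversals ^^ n" by (auto simp: run_partition_def)
    then show ?thesis using R run_weight_bounds(1)[of r] by (intro exI[of _ n]) auto
  qed
qed

text \<open>Single entries have total weight \<open>3 * k\<close>. For \<open>k < 3\<close> a value
  lacks two distinct neighbours, but a nonempty list is then already a run and three reversals fit
  the bound.\<close>

lemma sort_list: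
  assumes "distinct xs" "set xs = {..<k}"
  shows "\<exists>n. 2 * n \<le> 3 * k + 3 \<and> (xs, [0..<k]) \<in> end_reversals ^^ n"
proof -
  have len: "length xs = k" using assms by (metis card_lessThan distinct_card)
  consider "k = 0" | "k = 1" | "k = 2" | "3 \<le> k" by linarith
  then show ?thesis
  proof cases
    case 1
    with len show ?thesis by (intro exI[of _ 0]) simp
  next
    case 2
    with len obtain a where "xs = [a]" by (cases xs) auto
    then have "successively (adj k) xs" by simp
    from complete_run_sort[OF this assms] obtain n
      where "n \<le> 3" "(xs, [0..<k]) \<in> end_reversals ^^ n" using 2 by auto
    then show ?thesis using 2 by (intro exI[of _ n]) simp
  next
    case 3
    with len obtain a b where xs: "xs = [a, b]" by (cases xs; cases "tl xs") auto
    then have "a \<in> {..<k}" "b \<in> {..<k}" "a \<noteq> b" using assms by auto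
    then have "successively (adj k) xs" using 3 xs by (auto simp: adj_def up_step_iff)
    from complete_run_sort[OF this assms] obtain n
      where "n \<le> 3" "(xs, [0..<k]) \<in> end_reversals ^^ n" using 3 by auto
    then show ?thesis using 3 by (intro exI[of _ n]) simp
  next
    case 4
    let ?R = "map (\<lambda>x. [x]) xs"
    have concat: "concat ?R = xs" by (induction xs) auto
    have "weight ?R = 3 * length xs"
      by (induction xs) (auto simp: run_weight_def)
    moreover have "run_partition k ?R" unfolding run_partition_def concat using assms by simp
    ultimately show ?thesis using sort_runs[OF _ 4, of ?R] len unfolding concat by simp
  qed
qed

text \<open>Replacing entries by their positions in \<open>v\<close> turns \<open>v\<close> into
  \<open>[0..<length v]\<close>, and reversals commute with relabelling, so sorting
  suffices.\<close>

lemma end_reversals_connect: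
  assumes "distinct v" "distinct u" "set u = set v"
  shows "\<exists>n. 2 * n \<le> 3 * length v + 3 \<and> (u, v) \<in> end_reversals ^^ n"
proof -
  have "\<exists>xs. u = map (nth v) xs \<and> set xs \<subseteq> {..<length v}"
  proof -
    have "\<forall>a\<in>set u. \<exists>i<length v. v ! i = a" using assms(3) by (simp add: in_set_conv_nth)
    then obtain f where "\<forall>a\<in>set u. f a < length v \<and> v ! f a = a" by metis
    then show ?thesis by (intro exI[of _ "map f u"]) (auto simp: map_idI)
  qed
  then obtain xs where xs: "u = map (nth v) xs" "set xs \<subseteq> {..<length v}" by blast
  have "distinct xs" using assms(2) xs(1) by (simp add: distinct_map)
  have "length u = length v" using assms by (metis distinct_card)
  then have "card (set xs) = card {..<length v}"
    using distinct_card[OF \<open>distinct xs\<close>] xs(1) by simp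
  then have "set xs = {..<length v}" using xs(2) by (intro card_subset_eq) auto
  with sort_list \<open>distinct xs\<close> obtain n
    where n: "2 * n \<le> 3 * length v + 3" "(xs, [0..<length v]) \<in> end_reversals ^^ n" by blast
  have "(map (nth v) xs, map (nth v) [0..<length v]) \<in> end_reversals ^^ n"
    using end_reversals_map n(2) by (rule relpow_image)
  with n(1) xs(1) show ?thesis by (auto simp: map_nth)
qed

section \<open>Transfer to the graph and its diameter\<close>

lemma reversal_rel_connect:
  assumes "u \<in> perms k" "v \<in> perms k" "k \<ge> 1"
  shows "\<exists>n. real n \<le> 3 / 2 * real k + 4 \<and> (u, v) \<in> reversal_rel k ^^ n"
proof -
  have "distinct u" "distinct v" "set u = set v"
    using assms by (auto simp: perms_def permutations_of_set_def)
  with end_reversals_connect obtain n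
    where n: "2 * n \<le> 3 * length v + 3" "(u, v) \<in> end_reversals ^^ n" by blast
  then have "real (2 * n) \<le> real (3 * k + 3)"
    unfolding length_perms[OF assms(2)] of_nat_le_iff by simp
  then have "real n \<le> 3 / 2 * real k + 4" by simp
  with end_reversals_relpow_in_reversal_rel[OF n(2) assms(1,3)] show ?thesis by blast
qed

text \<open>The walk may be shorter than \<open>n\<close>, since reversals that fix a permutation
  are loops, absent from the graph.\<close>

lemma awalk_of_relpow:
  assumes "(u, v) \<in> reversal_rel k ^^ n" "u \<in> perms k"
  shows "\<exists>p. pre_digraph.awalk (with_proj (reversal_graph k)) u p v \<and> length p \<le> n"
  using assms
proof (induction n arbitrary: u)
  case 0
  interpret pair_graph "reversal_graph k" by (rule pair_graph_reversal_graph)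
  from 0 have "u \<in> pverts (reversal_graph k)" "u = v"
    by (simp_all add: reversal_graph_def)
  then have "awalk u [] v" by (simp add: awalk_Nil_iff)
  then show ?case by force
next
  case (Suc n)
  interpret pair_graph "reversal_graph k" by (rule pair_graph_reversal_graph)
  from Suc.prems(1) obtain w where w: "(u, w) \<in> reversal_rel k" "(w, v) \<in> reversal_rel k ^^ n"
    by (meson relpow_Suc_E2)
  then have "w \<in> perms k" by (auto simp: reversal_rel_def)
  with Suc.IH w(2) obtain p where p: "awalk w p v" "length p \<le> n" by blast
  show ?case
  proof (cases "u = w")
    case True
    with p show ?thesis by force
  next
    case False
    with w(1) have "(u, w) \<in> parcs (reversal_graph k)" by (simp add: reversal_graph_def)
    with p(1) have "awalk u ((u, w) # p) v" by (simp add: awalk_Cons_iff)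
    with p(2) show ?thesis by (intro exI[of _ "(u, w) # p"]) simp
  qed
qed

theorem theorem1p1:
  fixes k :: nat
  assumes "k \<ge> 1"
  shows "h k \<le> ereal (3 / 2 * real k + 4) \<and>
    (\<forall>\<pi>\<in>perms k. \<exists>n. real n \<le> 3 / 2 * real k + 4 \<and> (\<pi>, id_perm k) \<in> reversal_rel k ^^ n)"
proof
  show "\<forall>\<pi>\<in>perms k. \<exists>n. real n \<le> 3 / 2 * real k + 4 \<and> (\<pi>, id_perm k) \<in> reversal_rel k ^^ n"
    using reversal_rel_connect id_perm_in_perms assms by blast
  have "graph_dist (with_proj (reversal_graph k)) u v \<le> ereal (3 / 2 * real k + 4)"
    if uv: "u \<in> perms k" "v \<in> perms k" for u v
  proof -
    obtain n where n: "real n \<le> 3 / 2 * real k + 4" "(u, v) \<in> reversal_rel k ^^ n"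
      using reversal_rel_connect[OF uv assms] by blast
    then obtain p where p: "pre_digraph.awalk (with_proj (reversal_graph k)) u p v" "length p \<le> n"
      using awalk_of_relpow uv(1) by blast
    \<comment> \<open>The distance is an infimum over walks, so one short walk bounds it.\<close>
    have "graph_dist (with_proj (reversal_graph k)) u v \<le> ereal (real (length p))"
      unfolding graph_dist_reversal_graph using p(1) by (intro INF_lower) simp
    also have "\<dots> \<le> ereal (3 / 2 * real k + 4)" using n(1) p(2) by simp
    finally show ?thesis .
  qed
  then show "h k \<le> ereal (3 / 2 * real k + 4)"
    unfolding h_def graph_diameter_def by (intro SUP_least) (simp add: reversal_graph_def)
qed

end
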